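(* Let $F:[0,T)\times M\to\mathbb{R}^{n+1}$ be a (sufficiently smooth) solution of the hyperbolic mean curvature flow (HMCF), and let $Y=Y^\alpha\frac{\partial}{\partial y^\alpha}$ be any time-independent Killing vector field on $\mathbb{R}^{n+1}$. Then $$\frac{d}{dt}\left(\left\langle\frac{dF}{dt},Y\right\rangle d\mu_t\right)=\nabla^k\big((n-e)\langle F_k,Y\rangle\big)\,d\mu_t,$$ where $Y$ is evaluated at $F(t,x)$.
   Context: $M$ is an orientable smooth $n$-dimensional manifold and $F:[0,T)\times M\to\mathbb{R}^{n+1}$ is a smooth family of immersions. $\frac{d}{dt}$ is the time derivative at a fixed point of $M$ (also applied to time-dependent $n$-forms on $M$); in local coordinates $F_i:=\partial F/\partial x^i$; $g_{ij}:=\langle F_i,F_j\rangle$ is the induced metric, with Levi-Civita connection $\nabla$ and volume form $d\mu_t$; indices are raised with $g^{ij}$. $\nu$ is the unit normal along the hypersurface (inward pointing when $M$ is compact without boundary), $h_{ij}:=-\langle F_i,\nabla_j\nu\rangle$, $H:=g^{ij}h_{ij}$. $\sigma:=\langle\frac{dF}{dt},\nu\rangle$, $S_i:=\langle\frac{dF}{dt},F_i\rangle$, $d^\dagger S:=\nabla^iS_i$, $e:=\frac12\left(\left|\frac{dF}{dt}\right|^2+n\right)$. The equation (HMCF) is $$\frac{d^2}{dt^2}F=\big((e-|S|^2)H-\sigma\,d^\dagger S\big)\nu+\big((\sigma H-d^\dagger S)S^k-\nabla^ke\big)F_k.$$ *)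

theory Defs
  imports "HOL-Analysis.Analysis" "HOL-Library.Extended_Nat"
begin

section \<open>Differentiability classes\<close>

fun Ck_open :: "nat \<Rightarrow> 'a::euclidean_space set \<Rightarrow> ('a \<Rightarrow> 'b::real_normed_vector) \<Rightarrow> bool" where
  "Ck_open 0 W f \<longleftrightarrow> continuous_on W f"
| "Ck_open (Suc k) W f \<longleftrightarrow>
     (\<forall>x\<in>W. f differentiable (at x)) \<and> (\<forall>v. Ck_open k W (\<lambda>x. frechet_derivative f (at x) v))"

text \<open>For a set \<open>S\<close> that need not be open, such as \<open>[0,T) \<times> V\<close>, class \<open>C\<^sup>r\<close> means that \<open>f\<close>
  locally extends to a \<open>C\<^sup>r\<close> map on an open set. The value \<open>r = \<infinity>\<close> is smoothness.\<close>

definition C_on :: "enat \<Rightarrow> 'a::euclidean_space set \<Rightarrow> ('a \<Rightarrow> 'b::real_normed_vector) \<Rightarrow> bool" where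
  "C_on r S f \<longleftrightarrow>
     (\<forall>x\<in>S. \<exists>W g. open W \<and> x \<in> W \<and> (\<forall>k. enat k \<le> r \<longrightarrow> Ck_open k W g) \<and> (\<forall>y\<in>W \<inter> S. g y = f y))"

section \<open>Oriented smooth manifolds\<close>

type_synonym ('a, 'n) chart = "'a set \<times> ('a \<Rightarrow> real^'n)"

definition chart_image :: "('a, 'n) chart \<Rightarrow> (real^'n) set" where
  "chart_image c = snd c ` fst c"

definition chart_inv :: "('a, 'n) chart \<Rightarrow> real^'n \<Rightarrow> 'a" where
  "chart_inv c = inv_into (fst c) (snd c)"

definition is_chart :: "'a topology \<Rightarrow> ('a, 'n::finite) chart \<Rightarrow> bool" where
  "is_chart X c \<longleftrightarrow> openin X (fst c) \<and> open (chart_image c) \<and>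
     homeomorphic_map (subtopology X (fst c)) (top_of_set (chart_image c)) (snd c)"

definition transition :: "('a, 'n) chart \<Rightarrow> ('a, 'n) chart \<Rightarrow> real^'n \<Rightarrow> real^'n" where
  "transition c d = snd d \<circ> chart_inv c"

text \<open>The topological space \<open>X\<close> is an \<open>n\<close>-dimensional manifold without boundary, \<open>n = CARD('n)\<close>.
  The atlas \<open>A\<close> fixes the smooth structure together with an orientation: its charts are the
  positively oriented ones. Every orientable smooth manifold has such atlases, and maximality of
  \<open>A\<close> is not required.\<close>

definition oriented_smooth_manifold :: "'a topology \<Rightarrow> ('a, 'n::finite) chart set \<Rightarrow> bool" where
  "oriented_smooth_manifold X A \<longleftrightarrow>
     Hausdorff_space X \<and> second_countable X \<and>
     (\<forall>c\<in>A. is_chart X c) \<and> (\<Union>c\<in>A. fst c) = topspace X \<and>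
     (\<forall>c\<in>A. \<forall>d\<in>A. C_on \<infinity> (snd c ` (fst c \<inter> fst d)) (transition c d) \<and>
        (\<forall>x \<in> snd c ` (fst c \<inter> fst d).
           det (matrix (frechet_derivative (transition c d) (at x))) > 0))"

section \<open>Partial derivatives\<close>

text \<open>The partial derivative \<open>\<partial>f/\<partial>x\<^sup>i\<close> at the point \<open>p\<close> in the coordinates of the chart \<open>c\<close>.\<close>

definition pd :: "('a, 'n) chart \<Rightarrow> 'n::finite \<Rightarrow> ('a \<Rightarrow> 'b::real_normed_vector) \<Rightarrow> 'a \<Rightarrow> 'b" where
  "pd c i f p = vector_derivative (\<lambda>s. f (chart_inv c (snd c p + s *\<^sub>R axis i 1))) (at 0)"

definition time_interval :: "ereal \<Rightarrow> real set" where
  "time_interval T = {t. 0 \<le> t \<and> ereal t < T}"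

text \<open>The time derivative at a fixed point of the manifold, one-sided at \<open>t = 0\<close>.\<close>

definition dt :: "ereal \<Rightarrow> (real \<Rightarrow> 'a \<Rightarrow> 'b::real_normed_vector) \<Rightarrow> real \<Rightarrow> 'a \<Rightarrow> 'b" where
  "dt T f t p = vector_derivative (\<lambda>s. f s p) (at t within time_interval T)"

section \<open>Families of immersions\<close>

definition C_family ::
  "enat \<Rightarrow> ('a, 'n::finite) chart set \<Rightarrow> ereal \<Rightarrow> (real \<Rightarrow> 'a \<Rightarrow> real^'m::finite) \<Rightarrow> bool" where
  "C_family r A T f \<longleftrightarrow>
     (\<forall>c\<in>A. C_on r (time_interval T \<times> chart_image c) (\<lambda>(t, x). f t (chart_inv c x)))"

definition immersion :: "('a, 'n::finite) chart set \<Rightarrow> ('a \<Rightarrow> real^'m::finite) \<Rightarrow> bool" where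
  "immersion A f \<longleftrightarrow>
     (\<forall>c\<in>A. \<forall>x\<in>chart_image c.
        (f \<circ> chart_inv c) differentiable (at x) \<and> inj (frechet_derivative (f \<circ> chart_inv c) (at x)))"

text \<open>Either choice of the unit normal is admitted; the geometric expressions in the flow equation
  below do not change when \<open>\<nu>\<close> is replaced by \<open>-\<nu>\<close>.\<close>

definition unit_normal_field ::
  "('a, 'n::finite) chart set \<Rightarrow> ereal \<Rightarrow> (real \<Rightarrow> 'a \<Rightarrow> real^'m::finite) \<Rightarrow>
   (real \<Rightarrow> 'a \<Rightarrow> real^'m) \<Rightarrow> bool" where
  "unit_normal_field A T F \<nu> \<longleftrightarrow>
     C_family 1 A T \<nu> \<and>
     (\<forall>t\<in>time_interval T. \<forall>c\<in>A. \<forall>p\<in>fst c.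
        norm (\<nu> t p) = 1 \<and> (\<forall>i. \<nu> t p \<bullet> pd c i (F t) p = 0))"

section \<open>Geometry of the immersion in local coordinates\<close>

text \<open>In this section \<open>f\<close> is the immersion \<open>F t\<close> at a fixed time. A 1-form is given by its
  components \<open>\<omega> i\<close> in the chart \<open>c\<close>.\<close>

definition metric ::
  "('a, 'n::finite) chart \<Rightarrow> ('a \<Rightarrow> real^'m::finite) \<Rightarrow> 'a \<Rightarrow> real^'n^'n" where
  "metric c f p = (\<chi> i j. pd c i f p \<bullet> pd c j f p)"

definition inv_metric ::
  "('a, 'n::finite) chart \<Rightarrow> ('a \<Rightarrow> real^'m::finite) \<Rightarrow> 'a \<Rightarrow> real^'n^'n" where
  "inv_metric c f p = matrix_inv (metric c f p)"

definition raise_index ::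
  "('a, 'n::finite) chart \<Rightarrow> ('a \<Rightarrow> real^'m::finite) \<Rightarrow> ('n \<Rightarrow> 'a \<Rightarrow> real) \<Rightarrow> 'n \<Rightarrow> 'a \<Rightarrow> real" where
  "raise_index c f \<omega> k p = (\<Sum>l\<in>UNIV. inv_metric c f p $ k $ l * \<omega> l p)"

text \<open>\<open>christoffel c f k i j p\<close> is \<open>\<Gamma>\<^sup>k\<^sub>i\<^sub>j\<close> of the Levi-Civita connection.\<close>

definition christoffel ::
  "('a, 'n::finite) chart \<Rightarrow> ('a \<Rightarrow> real^'m::finite) \<Rightarrow> 'n \<Rightarrow> 'n \<Rightarrow> 'n \<Rightarrow> 'a \<Rightarrow> real" where
  "christoffel c f k i j p =
     (\<Sum>l\<in>UNIV. inv_metric c f p $ k $ l *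
        (pd c i (\<lambda>q. metric c f q $ j $ l) p + pd c j (\<lambda>q. metric c f q $ i $ l) p
          - pd c l (\<lambda>q. metric c f q $ i $ j) p)) / 2"

text \<open>\<open>nabla c f \<omega> i j p\<close> is \<open>\<nabla>\<^sub>i \<omega>\<^sub>j\<close>, and \<open>divergence c f \<omega> p\<close> is \<open>\<nabla>\<^sup>i \<omega>\<^sub>i = g\<^sup>i\<^sup>j \<nabla>\<^sub>i \<omega>\<^sub>j\<close>.\<close>

definition nabla ::
  "('a, 'n::finite) chart \<Rightarrow> ('a \<Rightarrow> real^'m::finite) \<Rightarrow> ('n \<Rightarrow> 'a \<Rightarrow> real) \<Rightarrow> 'n \<Rightarrow> 'n \<Rightarrow> 'a \<Rightarrow> real" where
  "nabla c f \<omega> i j p = pd c i (\<omega> j) p - (\<Sum>k\<in>UNIV. christoffel c f k i j p * \<omega> k p)"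

definition divergence ::
  "('a, 'n::finite) chart \<Rightarrow> ('a \<Rightarrow> real^'m::finite) \<Rightarrow> ('n \<Rightarrow> 'a \<Rightarrow> real) \<Rightarrow> 'a \<Rightarrow> real" where
  "divergence c f \<omega> p = (\<Sum>i\<in>UNIV. \<Sum>j\<in>UNIV. inv_metric c f p $ i $ j * nabla c f \<omega> i j p)"

definition second_ff ::
  "('a, 'n::finite) chart \<Rightarrow> ('a \<Rightarrow> real^'m::finite) \<Rightarrow> ('a \<Rightarrow> real^'m) \<Rightarrow> 'n \<Rightarrow> 'n \<Rightarrow> 'a \<Rightarrow> real" where
  "second_ff c f \<nu> i j p = - (pd c i f p \<bullet> pd c j \<nu> p)"

definition mean_curvature ::
  "('a, 'n::finite) chart \<Rightarrow> ('a \<Rightarrow> real^'m::finite) \<Rightarrow> ('a \<Rightarrow> real^'m) \<Rightarrow> 'a \<Rightarrow> real" where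
  "mean_curvature c f \<nu> p = (\<Sum>i\<in>UNIV. \<Sum>j\<in>UNIV. inv_metric c f p $ i $ j * second_ff c f \<nu> i j p)"

text \<open>The volume form at \<open>p\<close> on the \<open>n\<close> tangent vectors whose coordinates in the positively
  oriented chart \<open>c\<close> are the vectors \<open>v i\<close>, that is,
  \<open>sqrt (det g) dx\<^sup>1 \<and> \<dots> \<and> dx\<^sup>n\<close> applied to \<open>v\<close>.\<close>

definition volume_form ::
  "('a, 'n::finite) chart \<Rightarrow> ('a \<Rightarrow> real^'m::finite) \<Rightarrow> 'a \<Rightarrow> ('n \<Rightarrow> real^'n) \<Rightarrow> real" where
  "volume_form c f p v = sqrt (det (metric c f p)) * det (\<chi> i. v i)"

section \<open>The hyperbolic mean curvature flow\<close>

definition sigma ::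
  "ereal \<Rightarrow> (real \<Rightarrow> 'a \<Rightarrow> real^'m::finite) \<Rightarrow> (real \<Rightarrow> 'a \<Rightarrow> real^'m) \<Rightarrow> real \<Rightarrow> 'a \<Rightarrow> real" where
  "sigma T F \<nu> t p = dt T F t p \<bullet> \<nu> t p"

definition S_form ::
  "('a, 'n::finite) chart \<Rightarrow> ereal \<Rightarrow> (real \<Rightarrow> 'a \<Rightarrow> real^'m::finite) \<Rightarrow> real \<Rightarrow> 'n \<Rightarrow> 'a \<Rightarrow> real" where
  "S_form c T F t i p = dt T F t p \<bullet> pd c i (F t) p"

definition S_norm_sq ::
  "('a, 'n::finite) chart \<Rightarrow> ereal \<Rightarrow> (real \<Rightarrow> 'a \<Rightarrow> real^'m::finite) \<Rightarrow> real \<Rightarrow> 'a \<Rightarrow> real" where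
  "S_norm_sq c T F t p =
     (\<Sum>i\<in>UNIV. \<Sum>j\<in>UNIV. inv_metric c (F t) p $ i $ j * S_form c T F t i p * S_form c T F t j p)"

text \<open>The first argument of \<open>energy\<close> is the dimension \<open>n\<close> of the manifold.\<close>

definition energy ::
  "nat \<Rightarrow> ereal \<Rightarrow> (real \<Rightarrow> 'a \<Rightarrow> real^'m::finite) \<Rightarrow> real \<Rightarrow> 'a \<Rightarrow> real" where
  "energy n T F t p = ((norm (dt T F t p))\<^sup>2 + real n) / 2"

definition HMCF ::
  "('a, 'n::finite) chart set \<Rightarrow> ereal \<Rightarrow> (real \<Rightarrow> 'a \<Rightarrow> real^'m::finite) \<Rightarrow>
   (real \<Rightarrow> 'a \<Rightarrow> real^'m) \<Rightarrow> bool" where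
  "HMCF A T F \<nu> \<longleftrightarrow>
     (\<forall>t\<in>time_interval T. \<forall>c\<in>A. \<forall>p\<in>fst c.
        let e = energy CARD('n) T F t;
            H = mean_curvature c (F t) (\<nu> t) p;
            \<sigma> = sigma T F \<nu> t p;
            dS = divergence c (F t) (S_form c T F t) p;
            S_up = (\<lambda>k. raise_index c (F t) (S_form c T F t) k p);
            grad_e = (\<lambda>k. raise_index c (F t) (\<lambda>l. pd c l e) k p)
        in dt T (dt T F) t p =
             ((e p - S_norm_sq c T F t p) * H - \<sigma> * dS) *\<^sub>R \<nu> t p
             + (\<Sum>k\<in>UNIV. ((\<sigma> * H - dS) * S_up k - grad_e k) *\<^sub>R pd c k (F t) p))"

section \<open>Killing fields of Euclidean space\<close>

definition killing_field :: "(real^'m::finite \<Rightarrow> real^'m) \<Rightarrow> bool" where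
  "killing_field Y \<longleftrightarrow> C_on \<infinity> UNIV Y \<and>
     (\<forall>y v w. frechet_derivative Y (at y) v \<bullet> w + v \<bullet> frechet_derivative Y (at y) w = 0)"

end

theory Submission
  imports Defs
begin

text \<open>Write \<open>V = dF/dt\<close>. The volume form satisfies \<open>d/dt d\<mu> = \<tau> d\<mu>\<close> with
  \<open>\<tau> = g\<^sup>i\<^sup>j \<langle>\<partial>\<^sub>iV, F\<^sub>j\<rangle> = d\<^sup>\<dagger>S - \<sigma>H\<close>, and \<open>\<langle>V, DY(V)\<rangle> = 0\<close> because \<open>DY\<close> is skew, so the left-hand side
  is \<open>(\<langle>V\<^sub>t, Y\<rangle> + \<tau> \<langle>V, Y\<rangle>) d\<mu>\<close>. Inserting the equation and \<open>V = \<sigma>\<nu> + S\<^sup>kF\<^sub>k\<close>, the terms with \<open>d\<^sup>\<dagger>S\<close>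
  cancel and \<open>e - |S|\<^sup>2 - \<sigma>\<^sup>2 = n - e\<close> leaves \<open>(n - e)H\<langle>\<nu>, Y\<rangle> - \<nabla>\<^sup>ke \<langle>F\<^sub>k, Y\<rangle>\<close>. The right-hand side is the
  same expression, because \<open>\<nabla>\<^sup>k\<langle>F\<^sub>k, Y\<rangle> = H\<langle>\<nu>, Y\<rangle> + g\<^sup>i\<^sup>j\<langle>F\<^sub>j, DY(F\<^sub>i)\<rangle>\<close> by the Gauss formula and the
  last sum vanishes by skewness.\<close>

section \<open>Symmetry of mixed directional derivatives\<close>

text \<open>The mean value theorem is used twice: along \<open>v\<close> for the difference of two
  parallel segments, then along \<open>w\<close> for the derivative so obtained. The bound on
  \<open>h\<close> keeps the whole parallelogram inside the ball.\<close>

lemma mixed_increment_mvt: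
  fixes g :: "'a::real_normed_vector \<Rightarrow> real"
  assumes g: "\<And>x. x \<in> ball z d \<Longrightarrow> (g has_derivative g' x) (at x)"
    and g': "\<And>x. x \<in> ball z d \<Longrightarrow> ((\<lambda>y. g' y v) has_derivative g'' x) (at x)"
    and h: "0 < h" "h * (norm v + norm w) < d"
  obtains \<xi> where "\<xi> \<in> ball z d"
    "g (z + h *\<^sub>R v + h *\<^sub>R w) - g (z + h *\<^sub>R v) - g (z + h *\<^sub>R w) + g z = h\<^sup>2 * g'' \<xi> w"
proof -
  have in_ball: "z + s *\<^sub>R v + u *\<^sub>R w \<in> ball z d" if "0 \<le> s" "s \<le> h" "0 \<le> u" "u \<le> h" for s u
  proof -
    have "norm (s *\<^sub>R v + u *\<^sub>R w) \<le> s * norm v + u * norm w"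
      using that by (intro order.trans[OF norm_triangle_ineq]) simp
    also have "\<dots> \<le> h * norm v + h * norm w"
      using that by (intro add_mono mult_right_mono) auto
    also have "\<dots> < d" using h by (simp add: algebra_simps)
    finally have "dist (z + (s *\<^sub>R v + u *\<^sub>R w)) z < d" by (simp add: dist_norm)
    then show ?thesis by (simp add: dist_commute add.assoc)
  qed
  define \<phi> where "\<phi> s = g (z + s *\<^sub>R v + h *\<^sub>R w) - g (z + s *\<^sub>R v + 0 *\<^sub>R w)" for s
  have d1: "((\<lambda>s. g (z + s *\<^sub>R v + u *\<^sub>R w)) has_real_derivative g' (z + s *\<^sub>R v + u *\<^sub>R w) v) (at s)"
    if "0 \<le> s" "s \<le> h" "0 \<le> u" "u \<le> h" for s u
  proof -
    have lin: "linear (g' (z + s *\<^sub>R v + u *\<^sub>R w))"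
      using g[OF in_ball[OF that]] has_derivative_linear by blast
    have "((\<lambda>s. z + s *\<^sub>R v + u *\<^sub>R w) has_derivative (\<lambda>s. s *\<^sub>R v)) (at s)"
      by (auto intro!: derivative_eq_intros)
    from has_derivative_compose[OF this g[OF in_ball[OF that]]] show ?thesis
      by (simp add: has_field_derivative_def linear_cmul[OF lin] mult.commute[of _ "g' _ v"])
  qed
  have d2: "((\<lambda>u. g' (z + s *\<^sub>R v + u *\<^sub>R w) v) has_real_derivative g'' (z + s *\<^sub>R v + u *\<^sub>R w) w) (at u)"
    if "0 \<le> s" "s \<le> h" "0 \<le> u" "u \<le> h" for s u
  proof -
    have lin: "linear (g'' (z + s *\<^sub>R v + u *\<^sub>R w))"
      using g'[OF in_ball[OF that]] has_derivative_linear by blast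
    have "((\<lambda>u. z + s *\<^sub>R v + u *\<^sub>R w) has_derivative (\<lambda>u. u *\<^sub>R w)) (at u)"
      by (auto intro!: derivative_eq_intros)
    from has_derivative_compose[OF this g'[OF in_ball[OF that]]] show ?thesis
      by (simp add: has_field_derivative_def linear_cmul[OF lin] mult.commute[of _ "g'' _ w"])
  qed
  have "\<exists>s>0. s < h \<and> \<phi> h - \<phi> 0 = (h - 0) * (g' (z + s *\<^sub>R v + h *\<^sub>R w) v - g' (z + s *\<^sub>R v + 0 *\<^sub>R w) v)"
    unfolding \<phi>_def using h by (intro MVT2 DERIV_diff d1) auto
  then obtain s where s: "0 < s" "s < h"
    "\<phi> h - \<phi> 0 = h * (g' (z + s *\<^sub>R v + h *\<^sub>R w) v - g' (z + s *\<^sub>R v + 0 *\<^sub>R w) v)" by auto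
  have "\<exists>u>0. u < h \<and> g' (z + s *\<^sub>R v + h *\<^sub>R w) v - g' (z + s *\<^sub>R v + 0 *\<^sub>R w) v
      = (h - 0) * g'' (z + s *\<^sub>R v + u *\<^sub>R w) w"
    using h s by (intro MVT2 d2) auto
  then obtain u where u: "0 < u" "u < h"
    "g' (z + s *\<^sub>R v + h *\<^sub>R w) v - g' (z + s *\<^sub>R v + 0 *\<^sub>R w) v = h * g'' (z + s *\<^sub>R v + u *\<^sub>R w) w" by auto
  show ?thesis
  proof (rule that)
    show "z + s *\<^sub>R v + u *\<^sub>R w \<in> ball z d" using s u by (intro in_ball) auto
    show "g (z + h *\<^sub>R v + h *\<^sub>R w) - g (z + h *\<^sub>R v) - g (z + h *\<^sub>R w) + g z
        = h\<^sup>2 * g'' (z + s *\<^sub>R v + u *\<^sub>R w) w"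
      using s(3) u(3) by (simp add: \<phi>_def power2_eq_square)
  qed
qed

text \<open>Schwarz's theorem for two fixed directions: the second-order increment is symmetric in
  \<open>v\<close> and \<open>w\<close>, so near \<open>z\<close> some value of \<open>gv\<close>
  equals some value of \<open>gw\<close>, and continuity forbids a gap at \<open>z\<close>.\<close>

lemma mixed_directional_derivatives_eq_real:
  fixes g :: "'a::real_normed_vector \<Rightarrow> real"
  assumes W: "open W" "z \<in> W"
    and g: "\<And>x. x \<in> W \<Longrightarrow> (g has_derivative g' x) (at x)"
    and gv: "\<And>x. x \<in> W \<Longrightarrow> ((\<lambda>y. g' y v) has_derivative gv x) (at x)"
    and gw: "\<And>x. x \<in> W \<Longrightarrow> ((\<lambda>y. g' y w) has_derivative gw x) (at x)"
    and cont: "continuous_on W (\<lambda>x. gv x w)" "continuous_on W (\<lambda>x. gw x v)"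
  shows "gv z w = gw z v"
proof (rule ccontr)
  assume "gv z w \<noteq> gw z v"
  define e where "e = \<bar>gv z w - gw z v\<bar> / 2"
  have e: "e > 0" using \<open>gv z w \<noteq> gw z v\<close> by (simp add: e_def)
  have "isCont (\<lambda>x. gv x w) z" "isCont (\<lambda>x. gw x v) z"
    using cont W continuous_on_eq_continuous_at by blast+
  then have "\<exists>d>0. \<forall>x. dist x z < d \<longrightarrow> dist (gv x w) (gv z w) < e"
     "\<exists>d>0. \<forall>x. dist x z < d \<longrightarrow> dist (gw x v) (gw z v) < e"
    using e unfolding continuous_at_eps_delta by blast+
  then obtain d1 d2 where d1: "d1 > 0" "\<And>x. dist x z < d1 \<Longrightarrow> dist (gv x w) (gv z w) < e"
    and d2: "d2 > 0" "\<And>x. dist x z < d2 \<Longrightarrow> dist (gw x v) (gw z v) < e" by blast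
  obtain d3 where d3: "d3 > 0" "ball z d3 \<subseteq> W" using W openE by blast
  define d where "d = min d1 (min d2 d3)"
  have d: "d > 0" "ball z d \<subseteq> W" using d1 d2 d3 by (auto simp: d_def)
  \<comment> \<open>The summand 1 keeps the denominator positive when both directions vanish and
    makes the bound on the parallelogram strict.\<close>
  define h where "h = d / (norm v + norm w + 1)"
  have pos: "norm v + norm w + 1 > 0" by (simp add: add_nonneg_pos)
  have h: "h > 0" using d pos by (simp add: h_def)
  have "h * (norm v + norm w) < h * (norm v + norm w + 1)" using h by simp
  also have "\<dots> = d" using pos unfolding h_def by (metis nonzero_eq_divide_eq less_irrefl)
  finally have hd: "h * (norm v + norm w) < d" .
  then have hd': "h * (norm w + norm v) < d" by (simp add: add.commute)
  obtain x where x: "x \<in> ball z d"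
    "g (z + h *\<^sub>R v + h *\<^sub>R w) - g (z + h *\<^sub>R v) - g (z + h *\<^sub>R w) + g z = h\<^sup>2 * gv x w"
    using mixed_increment_mvt[of z d g g' v gv h w] g gv h hd d(2) by blast
  obtain y where y: "y \<in> ball z d"
    "g (z + h *\<^sub>R w + h *\<^sub>R v) - g (z + h *\<^sub>R w) - g (z + h *\<^sub>R v) + g z = h\<^sup>2 * gw y v"
    using mixed_increment_mvt[of z d g g' w gw h v] g gw h hd' d(2) by blast
  have "z + h *\<^sub>R w + h *\<^sub>R v = z + h *\<^sub>R v + h *\<^sub>R w" by (simp add: algebra_simps)
  then have "h\<^sup>2 * gv x w = h\<^sup>2 * gw y v"
    unfolding x(2)[symmetric] y(2)[symmetric] by (simp only:)
  then have "gv x w = gw y v" using h by simp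
  moreover have "dist (gv x w) (gv z w) < e" "dist (gw y v) (gw z v) < e"
    using x(1) y(1) by (auto intro!: d1 d2 simp: d_def dist_commute)
  ultimately show False by (auto simp: dist_real_def e_def abs_if split: if_splits)
qed

lemma mixed_directional_derivatives_eq:
  fixes G :: "'a::real_normed_vector \<Rightarrow> 'b::real_inner"
  assumes W: "open W" "z \<in> W"
    and G: "\<And>x. x \<in> W \<Longrightarrow> (G has_derivative G' x) (at x)"
    and Gv: "\<And>x. x \<in> W \<Longrightarrow> ((\<lambda>y. G' y v) has_derivative Gv x) (at x)"
    and Gw: "\<And>x. x \<in> W \<Longrightarrow> ((\<lambda>y. G' y w) has_derivative Gw x) (at x)"
    and cont: "continuous_on W (\<lambda>x. Gv x w)" "continuous_on W (\<lambda>x. Gw x v)"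
  shows "Gv z w = Gw z v"
proof (rule vector_eq_rdot[THEN iffD1], rule allI)
  fix b
  show "Gv z w \<bullet> b = Gw z v \<bullet> b"
    by (rule mixed_directional_derivatives_eq_real[OF W, of "\<lambda>x. G x \<bullet> b" "\<lambda>x y. G' x y \<bullet> b" v
          "\<lambda>x y. Gv x y \<bullet> b" w "\<lambda>x y. Gw x y \<bullet> b"])
       (auto intro!: has_derivative_inner_left G Gv Gw continuous_intros cont)
qed

section \<open>Determinants, Gram matrices and frames\<close>

lemma has_real_derivative_prod_within:
  assumes f: "\<And>i. i \<in> I \<Longrightarrow> (f i has_real_derivative f' i) (at t within S)"
  shows "((\<lambda>s. \<Prod>i\<in>I. f i s) has_real_derivative (\<Sum>i\<in>I. f' i * (\<Prod>j\<in>I - {i}. f j t))) (at t within S)"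
proof -
  have "((\<lambda>s. \<Prod>i\<in>I. f i s) has_derivative (\<lambda>y. \<Sum>i\<in>I. f' i * y * (\<Prod>j\<in>I - {i}. f j t))) (at t within S)"
    using f by (intro has_derivative_prod) (simp add: has_field_derivative_def)
  then show ?thesis
    by (rule has_derivative_imp_has_field_derivative) (simp add: sum_distrib_left mult_ac)
qed

text \<open>In the Leibniz formula the product rule differentiates one factor and leaves the others
  at the identity matrix. A permutation other than \<open>id\<close> moves at least two points, so
  an off-diagonal zero survives among them; only the trace remains.\<close>

lemma has_real_derivative_det_mat_1:
  fixes A :: "real \<Rightarrow> real^'n^'n"
  assumes A: "\<And>i j. ((\<lambda>s. A s $ i $ j) has_real_derivative A' i j) (at t within S)"
    and A1: "A t = mat 1"
  shows "((\<lambda>s. det (A s)) has_real_derivative (\<Sum>i\<in>UNIV. A' i i)) (at t within S)"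
proof -
  let ?P = "{p. p permutes (UNIV :: 'n set)}"
  have vanish: "(\<Prod>j\<in>UNIV - {i}. A t $ j $ p j) = (if p = id then 1 else 0)" if p: "p permutes UNIV" for i p
  proof (cases "p = id")
    case True
    then show ?thesis by (auto simp: A1 mat_def)
  next
    case False
    have "\<exists>j. j \<noteq> i \<and> p j \<noteq> j"
    proof (rule ccontr)
      assume "\<not> ?thesis"
      then have *: "p j = j" if "j \<noteq> i" for j using that by blast
      moreover have "p i = i"
      proof (rule ccontr)
        assume "p i \<noteq> i"
        then have "p (p i) = p i" using * by blast
        then show False using p \<open>p i \<noteq> i\<close> by (metis permutes_inverses(2))
      qed
      ultimately have "p = id" by (intro ext) (metis id_apply)
      with False show False by simp
    qed
    then obtain j where "j \<in> UNIV - {i}" "A t $ j $ p j = 0" by (auto simp: A1 mat_def)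
    then have "(\<Prod>j\<in>UNIV - {i}. A t $ j $ p j) = 0" by (intro prod_zero) auto
    then show ?thesis using False by simp
  qed
  have "((\<lambda>s. det (A s)) has_real_derivative
      (\<Sum>p\<in>?P. of_int (sign p) * (\<Sum>i\<in>UNIV. A' i (p i) * (\<Prod>j\<in>UNIV - {i}. A t $ j $ p j)))) (at t within S)"
    unfolding det_def
    by (intro DERIV_sum DERIV_cmult has_real_derivative_prod_within A)
  also have "(\<Sum>p\<in>?P. of_int (sign p) * (\<Sum>i\<in>UNIV. A' i (p i) * (\<Prod>j\<in>UNIV - {i}. A t $ j $ p j)))
     = (\<Sum>p\<in>?P. if p = id then (\<Sum>i\<in>UNIV. A' i i) else 0)"
    by (rule sum.cong) (auto simp: vanish sign_id)
  also have "\<dots> = (\<Sum>i\<in>UNIV. A' i i)"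
    by (subst sum.delta) (auto simp: permutes_id)
  finally show ?thesis .
qed

text \<open>Jacobi's formula. The factorization
  \<open>det (A s) = det (A s ** B) * det (A t)\<close> reduces it to a matrix that is the identity
  at \<open>s = t\<close>.\<close>

lemma has_real_derivative_det:
  fixes A :: "real \<Rightarrow> real^'n^'n"
  assumes A: "\<And>i j. ((\<lambda>s. A s $ i $ j) has_real_derivative A' i j) (at t within S)"
    and inv: "A t ** B = mat 1"
  shows "((\<lambda>s. det (A s)) has_real_derivative det (A t) * (\<Sum>i\<in>UNIV. \<Sum>j\<in>UNIV. B $ i $ j * A' j i)) (at t within S)"
proof -
  have BA: "B ** A t = mat 1" using inv matrix_left_right_inverse by blast
  have eq: "det (A s) = det (A s ** B) * det (A t)" for s
    by (metis BA det_mul matrix_mul_assoc matrix_mul_rid)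
  have "((\<lambda>s. det (A s ** B)) has_real_derivative (\<Sum>i\<in>UNIV. \<Sum>j\<in>UNIV. A' i j * B $ j $ i)) (at t within S)"
    by (rule has_real_derivative_det_mat_1)
       (auto simp: matrix_matrix_mult_def inv[unfolded matrix_matrix_mult_def] intro!: DERIV_sum DERIV_cmult_right A)
  then have "((\<lambda>s. det (A s ** B) * det (A t)) has_real_derivative
      (\<Sum>i\<in>UNIV. \<Sum>j\<in>UNIV. A' i j * B $ j $ i) * det (A t)) (at t within S)"
    by (rule DERIV_cmult_right)
  moreover have "(\<Sum>i\<in>UNIV. \<Sum>j\<in>UNIV. A' i j * B $ j $ i) = (\<Sum>i\<in>UNIV. \<Sum>j\<in>UNIV. B $ i $ j * A' j i)"
    by (subst sum.swap) (simp add: mult.commute)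
  ultimately show ?thesis unfolding eq[symmetric] by (simp add: mult.commute)
qed

text \<open>The sign of the determinant is irrelevant, because \<open>sqrt\<close> is extended to the negative
  reals as an odd function.\<close>

lemma has_real_derivative_sqrt_det:
  fixes A :: "real \<Rightarrow> real^'n^'n"
  assumes A: "\<And>i j. ((\<lambda>s. A s $ i $ j) has_real_derivative A' i j) (at t within S)"
    and inv: "A t ** B = mat 1"
  shows "((\<lambda>s. sqrt (det (A s))) has_real_derivative
    sqrt (det (A t)) * (\<Sum>i\<in>UNIV. \<Sum>j\<in>UNIV. B $ i $ j * A' j i) / 2) (at t within S)"
proof -
  have nz: "det (A t) \<noteq> 0" using inv by (metis det_I det_mul mult_zero_left zero_neq_one)
  have "DERIV sqrt (det (A t)) :> sqrt (det (A t)) / det (A t) / 2"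
    using nz by (intro DERIV_real_sqrt_generic)
      (auto simp: field_simps real_sqrt_mult_self abs_if)
  from DERIV_chain2[OF this has_real_derivative_det[OF A inv]] show ?thesis
    using nz by simp
qed

text \<open>Together with \<open>\<nu>\<close> the \<open>CARD('n)\<close> independent vectors form
  a basis of the ambient space. What is left of \<open>w\<close> without its normal component is
  orthogonal to this basis, hence to itself.\<close>

lemma orthogonal_to_hyperplane_frame:
  fixes a :: "'n::finite \<Rightarrow> real^'m::finite"
  assumes codim: "CARD('m) = CARD('n) + 1"
    and indep: "\<And>x. (\<Sum>i\<in>UNIV. x i *\<^sub>R a i) = 0 \<Longrightarrow> x = (\<lambda>_. 0)"
    and \<nu>: "norm \<nu> = 1" "\<And>i. \<nu> \<bullet> a i = 0"
    and w: "\<And>i. w \<bullet> a i = 0"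
  shows "w = (w \<bullet> \<nu>) *\<^sub>R \<nu>"
proof -
  \<comment> \<open>\<open>independent\<close> concerns the set \<open>range a\<close>, so
    repetitions are excluded first: equal vectors would give a relation with coefficients 1 and
    -1.\<close>
  have inj: "inj a"
  proof (rule injI, rule ccontr)
    fix i j assume ij: "a i = a j" "i \<noteq> j"
    have "(\<Sum>k\<in>UNIV. (if k = i then 1 else if k = j then -1 else 0) *\<^sub>R a k)
      = (\<Sum>k\<in>UNIV. (if k = i then a i else 0) + (if k = j then - a j else 0))"
      using ij(2) by (intro sum.cong) auto
    also have "\<dots> = 0" using ij(1) by (simp add: sum.distrib)
    finally have "(\<lambda>k. if k = i then 1 else if k = j then -1 else (0::real)) = (\<lambda>_. 0)" by (rule indep)
    then show False by (metis zero_neq_one)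
  qed
  have ind: "independent (range a)"
  proof (rule independent_if_scalars_zero)
    show "finite (range a)" by simp
    fix f x assume f: "(\<Sum>x\<in>range a. f x *\<^sub>R x) = 0" and x: "x \<in> range a"
    have "(\<Sum>i\<in>UNIV. f (a i) *\<^sub>R a i) = 0" using f by (simp add: sum.reindex[OF inj])
    from indep[OF this] x show "f x = 0" by (auto dest: fun_cong)
  qed
  have "\<nu> \<notin> span (range a)"
  proof
    assume "\<nu> \<in> span (range a)"
    then have "orthogonal \<nu> \<nu>" 
      by (rule orthogonal_to_span) (auto simp: orthogonal_def \<nu>)
    then show False using \<nu>(1) by (simp add: orthogonal_def)
  qed
  then have notin: "\<nu> \<notin> span (range a)" "\<nu> \<notin> range a" by (auto intro: span_base)
  have "independent (insert \<nu> (range a))"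
    using ind notin by (simp add: independent_insert)
  moreover have "card (insert \<nu> (range a)) = CARD('m)"
    using notin by (simp add: card_image[OF inj] codim)
  moreover have "dim (UNIV :: (real^'m) set) = CARD('m)" by simp
  ultimately have "UNIV \<subseteq> span (insert \<nu> (range a))"
    by (intro card_ge_dim_independent) (simp_all only: subset_UNIV order_refl not_False_eq_True)
  then have "w - (w \<bullet> \<nu>) *\<^sub>R \<nu> \<in> span (insert \<nu> (range a))" by auto
  then have "orthogonal (w - (w \<bullet> \<nu>) *\<^sub>R \<nu>) (w - (w \<bullet> \<nu>) *\<^sub>R \<nu>)"
    by (rule orthogonal_to_span)
       (use \<nu> w in \<open>auto simp: orthogonal_def inner_diff_left power2_norm_eq_inner[symmetric] norm_eq_1\<close>)
  then show ?thesis by (simp add: orthogonal_def)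
qed

text \<open>The quadratic form of the Gram matrix at \<open>x\<close> is the squared norm of the
  combination with coefficients \<open>x\<close>, so a kernel vector yields a vanishing
  combination.\<close>

lemma gram_matrix_invertible:
  fixes a :: "'n::finite \<Rightarrow> 'b::real_inner"
  assumes indep: "\<And>x. (\<Sum>i\<in>UNIV. x i *\<^sub>R a i) = 0 \<Longrightarrow> x = (\<lambda>_. 0)"
  shows "invertible (\<chi> i j. a i \<bullet> a j)"
  unfolding invertible_left_inverse matrix_left_invertible_ker
proof (intro allI impI)
  fix x :: "real^'n"
  assume 0: "(\<chi> i j. a i \<bullet> a j) *v x = 0"
  have "(\<Sum>i\<in>UNIV. x $ i *\<^sub>R a i) \<bullet> (\<Sum>i\<in>UNIV. x $ i *\<^sub>R a i) = x \<bullet> ((\<chi> i j. a i \<bullet> a j) *v x)"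
    by (simp add: inner_sum_left inner_sum_right matrix_vector_mult_def inner_vec_def sum_distrib_left mult_ac
        inner_commute)
  then have "(\<lambda>i. x $ i) = (\<lambda>_. 0)" using 0 by (intro indep) simp
  then show "x = 0" by (auto simp: vec_eq_iff dest: fun_cong)
qed

section \<open>Partial and time derivatives in a chart\<close>

lemma chart_inv:
  assumes "is_chart X c"
  shows "p \<in> fst c \<Longrightarrow> snd c p \<in> chart_image c"
    and "p \<in> fst c \<Longrightarrow> chart_inv c (snd c p) = p"
    and "y \<in> chart_image c \<Longrightarrow> chart_inv c y \<in> fst c"
    and "y \<in> chart_image c \<Longrightarrow> snd c (chart_inv c y) = y"
proof -
  have "topspace X \<inter> fst c = fst c"
    using assms openin_subset[of X "fst c"] by (auto simp: is_chart_def)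
  then have "inj_on (snd c) (fst c)"
    using assms homeomorphic_imp_injective_map by (fastforce simp: is_chart_def)
  then show "p \<in> fst c \<Longrightarrow> snd c p \<in> chart_image c" "p \<in> fst c \<Longrightarrow> chart_inv c (snd c p) = p"
    "y \<in> chart_image c \<Longrightarrow> chart_inv c y \<in> fst c" "y \<in> chart_image c \<Longrightarrow> snd c (chart_inv c y) = y"
    by (simp_all add: chart_image_def chart_inv_def inv_into_into f_inv_into_f)
qed

text \<open>\<open>pd\<close> is a total operator with an unspecified value where no derivative
  exists; this relation also records existence, which the calculus rules require.\<close>

definition has_pd ::
  "('a, 'n::finite) chart \<Rightarrow> 'n \<Rightarrow> ('a \<Rightarrow> 'b::real_normed_vector) \<Rightarrow> 'b \<Rightarrow> 'a \<Rightarrow> bool" where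
  "has_pd c i f f' p \<longleftrightarrow>
     ((\<lambda>s. f (chart_inv c (snd c p + s *\<^sub>R axis i 1))) has_vector_derivative f') (at 0)"

lemma has_pd_imp_pd: "has_pd c i f f' p \<Longrightarrow> pd c i f p = f'"
  by (simp add: has_pd_def pd_def vector_derivative_at)

lemma has_pd_pd: "has_pd c i f f' p \<Longrightarrow> has_pd c i f (pd c i f p) p"
  using has_pd_imp_pd by metis

lemma has_vector_derivative_transform_eventually:
  assumes "(f has_vector_derivative f') (at x)" "\<forall>\<^sub>F y in nhds x. f y = g y"
  shows "(g has_vector_derivative f') (at x)"
  using assms has_vector_derivative_cong_ev[of UNIV f g x f'] eventually_nhds_x_imp_x[OF assms(2)] by simp

lemma eventually_chart_line:
  assumes "is_chart X c" "p \<in> fst c"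
  shows "\<forall>\<^sub>F s in nhds (0::real). snd c p + s *\<^sub>R axis i 1 \<in> chart_image c"
proof -
  have "open (chart_image c)" "snd c p \<in> chart_image c"
    using assms(1) chart_inv(1)[OF assms] by (simp_all add: is_chart_def)
  moreover have "((\<lambda>s. snd c p + s *\<^sub>R axis i 1) \<longlongrightarrow> snd c p + 0 *\<^sub>R axis i 1) (nhds 0)"
    by (intro tendsto_add tendsto_scaleR tendsto_const filterlim_ident)
  ultimately show ?thesis by (auto dest: topological_tendstoD)
qed

text \<open>Serves to differentiate orthogonality relations that are known only on the domain of the
  chart.\<close>

lemma has_pd_const_on_chart:
  assumes "is_chart X c" "p \<in> fst c" "\<And>q. q \<in> fst c \<Longrightarrow> f q = k"
  shows "has_pd c i f 0 p"
  unfolding has_pd_def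
proof (rule has_vector_derivative_transform_eventually)
  show "((\<lambda>s. k) has_vector_derivative 0) (at 0)" by simp
  show "\<forall>\<^sub>F s in nhds 0. k = f (chart_inv c (snd c p + s *\<^sub>R axis i 1))"
    using eventually_chart_line[OF assms(1,2), of i]
    by eventually_elim (use assms(3) chart_inv(3)[OF assms(1)] in simp)
qed

lemma has_pd_inner:
  assumes "is_chart X c" "p \<in> fst c" "has_pd c i f f' p" "has_pd c i g g' p"
  shows "has_pd c i (\<lambda>q. f q \<bullet> g q) (f p \<bullet> g' + f' \<bullet> g p) p"
  using bounded_bilinear.has_vector_derivative[OF bounded_bilinear_inner
      assms(3)[unfolded has_pd_def] assms(4)[unfolded has_pd_def]]
  by (simp add: has_pd_def chart_inv(2)[OF assms(1,2)])

lemma has_pd_scaleR: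
  fixes u :: "'a \<Rightarrow> real"
  assumes "is_chart X c" "p \<in> fst c" "has_pd c i u u' p" "has_pd c i g g' p"
  shows "has_pd c i (\<lambda>q. u q *\<^sub>R g q) (u p *\<^sub>R g' + u' *\<^sub>R g p) p"
  using bounded_bilinear.has_vector_derivative[OF bounded_bilinear_scaleR
      assms(3)[unfolded has_pd_def] assms(4)[unfolded has_pd_def]]
  by (simp add: has_pd_def chart_inv(2)[OF assms(1,2)])

lemma has_pd_compose:
  assumes "is_chart X c" "p \<in> fst c" "has_pd c i f f' p" "(Y has_derivative Y') (at (f p))"
  shows "has_pd c i (\<lambda>q. Y (f q)) (Y' f') p"
proof -
  have f: "((\<lambda>s. f (chart_inv c (snd c p + s *\<^sub>R axis i 1))) has_derivative (\<lambda>s. s *\<^sub>R f')) (at 0)"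
    using assms(3) by (simp add: has_pd_def has_vector_derivative_def)
  have lin: "linear Y'" using assms(4) has_derivative_linear by blast
  show ?thesis
    using has_derivative_compose[OF f, of Y Y'] assms(4)
    by (simp add: has_pd_def has_vector_derivative_def chart_inv(2)[OF assms(1,2)] linear_cmul[OF lin])
qed

text \<open>Some interval \<open>{t..u}\<close> with \<open>t < u < T\<close> is admissible for
  every admissible \<open>t\<close>, including 0. Hence derivatives within the time interval are
  unique and determine \<open>dt\<close>.\<close>

lemma at_within_time_interval_neq_bot:
  assumes "0 < T" "t \<in> time_interval T"
  shows "at t within time_interval T \<noteq> bot"
proof -
  obtain u where u: "ereal t < ereal u" "ereal u < T"
    using assms ereal_dense2[of "ereal t" T] by (auto simp: time_interval_def)
  have "{t..u} \<subseteq> time_interval T"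
  proof
    fix s assume "s \<in> {t..u}"
    then show "s \<in> time_interval T" using u assms
      by (auto simp: time_interval_def) (metis ereal_less_eq(3) order.strict_trans1)
  qed
  then have "at t within {t..u} \<le> at t within time_interval T" by (rule at_le)
  moreover have "at t within {t..u} \<noteq> bot"
    using u by (simp add: trivial_limit_within islimpt_Icc)
  ultimately show ?thesis by (metis bot.extremum_uniqueI)
qed

lemma has_vector_derivative_imp_dt:
  assumes "0 < T" "t \<in> time_interval T" "((\<lambda>s. f s p) has_vector_derivative f') (at t within time_interval T)"
  shows "dt T f t p = f'"
  unfolding dt_def by (rule vector_derivative_within[OF at_within_time_interval_neq_bot[OF assms(1,2)] assms(3)])

text \<open>The map \<open>G\<close> lives on an open set of space-time, also across \<open>t = 0\<close>, where \<open>f\<close> has only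
  one-sided time derivatives; so mixed derivatives of \<open>f\<close> can be interchanged through \<open>G\<close>.\<close>

definition local_rep ::
  "('a, 'n::finite) chart \<Rightarrow> ereal \<Rightarrow> (real \<times> (real^'n)) set \<Rightarrow> (real \<times> (real^'n) \<Rightarrow> 'b) \<Rightarrow>
   (real \<Rightarrow> 'a \<Rightarrow> 'b) \<Rightarrow> bool" where
  "local_rep c T W G f \<longleftrightarrow>
     (\<forall>s y. (s, y) \<in> W \<longrightarrow> s \<in> time_interval T \<longrightarrow> y \<in> chart_image c \<longrightarrow> G (s, y) = f s (chart_inv c y))"

lemma local_rep_has_pd:
  assumes c: "is_chart X c" "p \<in> fst c" and W: "open W" "(t, snd c p) \<in> W"
    and t: "t \<in> time_interval T" and rep: "local_rep c T W G f"
    and G: "(G has_derivative G') (at (t, snd c p))"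
  shows "has_pd c i (f t) (G' (0, axis i 1)) p"
proof -
  let ?l = "\<lambda>s. (t, snd c p + s *\<^sub>R axis i (1::real))"
  have lin: "linear G'" using G has_derivative_linear by blast
  have "(?l has_derivative (\<lambda>s. (0, s *\<^sub>R axis i 1))) (at 0)"
    by (auto intro!: derivative_eq_intros)
  from has_derivative_compose[OF this, of G G'] G
  have "((\<lambda>s. G (?l s)) has_derivative (\<lambda>s. G' (0, s *\<^sub>R axis i 1))) (at 0)" by simp
  moreover have "(\<lambda>s. G' (0, s *\<^sub>R axis i 1)) = (\<lambda>s. s *\<^sub>R G' (0, axis i 1))"
  proof
    show "G' (0, s *\<^sub>R axis i 1) = s *\<^sub>R G' (0, axis i 1)" for s :: real
      using linear_cmul[OF lin, of s "(0, axis i 1)"] by simp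
  qed
  ultimately have "((\<lambda>s. G (?l s)) has_vector_derivative G' (0, axis i 1)) (at 0)"
    unfolding has_vector_derivative_def by (rule has_derivative_eq_rhs)
  moreover have "\<forall>\<^sub>F s in nhds 0. G (?l s) = f t (chart_inv c (snd c p + s *\<^sub>R axis i 1))"
  proof -
    have "(?l \<longlongrightarrow> ?l 0) (nhds 0)"
      by (intro tendsto_Pair tendsto_add tendsto_scaleR tendsto_const filterlim_ident)
    then have "\<forall>\<^sub>F s in nhds 0. ?l s \<in> W" using W by (auto dest: topological_tendstoD)
    with eventually_chart_line[OF c, of i] show ?thesis
      by eventually_elim (use rep t in \<open>auto simp: local_rep_def\<close>)
  qed
  ultimately show ?thesis
    unfolding has_pd_def by (rule has_vector_derivative_transform_eventually)
qed

text \<open>Along the time line through \<open>p\<close> the agreement of \<open>G\<close> and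
  \<open>f\<close> holds only for admissible times, so the two-sided derivative of \<open>G\<close>
  passes to a derivative within the time interval.\<close>

lemma local_rep_has_dt:
  assumes c: "is_chart X c" "p \<in> fst c" and W: "open W" "(t, snd c p) \<in> W"
    and t: "t \<in> time_interval T" and rep: "local_rep c T W G f"
    and G: "(G has_derivative G') (at (t, snd c p))"
  shows "((\<lambda>s. f s p) has_vector_derivative G' (1, 0)) (at t within time_interval T)"
proof -
  let ?l = "\<lambda>s. (s, snd c p)"
  have lin: "linear G'" using G has_derivative_linear by blast
  have "(?l has_derivative (\<lambda>s. (s, 0))) (at t within time_interval T)"
    by (auto intro!: derivative_eq_intros)
  from has_derivative_compose[OF this, of G G'] G
  have "((\<lambda>s. G (?l s)) has_derivative (\<lambda>s. G' (s, 0))) (at t within time_interval T)" by simp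
  moreover have "(\<lambda>s. G' (s, 0)) = (\<lambda>s. s *\<^sub>R G' (1, 0))"
  proof
    show "G' (s, 0) = s *\<^sub>R G' (1, 0)" for s :: real
      using linear_cmul[OF lin, of s "(1, 0)"] by simp
  qed
  ultimately have 1: "((\<lambda>s. G (?l s)) has_vector_derivative G' (1, 0)) (at t within time_interval T)"
    unfolding has_vector_derivative_def by (rule has_derivative_eq_rhs)
  have "(?l \<longlongrightarrow> ?l t) (nhds t)" by (intro tendsto_Pair tendsto_const filterlim_ident)
  then have "\<forall>\<^sub>F s in nhds t. ?l s \<in> W" using W by (auto dest: topological_tendstoD)
  then obtain d where d: "d > 0" "\<And>s. dist s t < d \<Longrightarrow> ?l s \<in> W"
    unfolding eventually_nhds_metric by blast
  show ?thesis
    by (rule has_vector_derivative_transform_within[OF 1 \<open>d > 0\<close> t])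
       (use d rep chart_inv[OF c(1)] c(2) in \<open>auto simp: local_rep_def\<close>)
qed

text \<open>A derivative of the representative represents the derivative on the same open set, so
  the construction can be iterated to second order; likewise for time below.\<close>

lemma local_rep_pd:
  assumes c: "is_chart X c" and W: "open W" and rep: "local_rep c T W G f"
    and G: "\<And>z. z \<in> W \<Longrightarrow> (G has_derivative G' z) (at z)"
  shows "local_rep c T W (\<lambda>z. G' z (0, axis i 1)) (\<lambda>s. pd c i (f s))"
  unfolding local_rep_def
proof (intro allI impI)
  fix s y assume *: "(s, y) \<in> W" "s \<in> time_interval T" "y \<in> chart_image c"
  have "has_pd c i (f s) (G' (s, snd c (chart_inv c y)) (0, axis i 1)) (chart_inv c y)"
    using * chart_inv[OF c] by (intro local_rep_has_pd[OF c _ W _ _ rep G]) auto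
  then show "G' (s, y) (0, axis i 1) = pd c i (f s) (chart_inv c y)"
    using * chart_inv[OF c] by (simp add: has_pd_imp_pd)
qed

lemma local_rep_dt:
  assumes c: "is_chart X c" and T: "0 < T" and W: "open W" and rep: "local_rep c T W G f"
    and G: "\<And>z. z \<in> W \<Longrightarrow> (G has_derivative G' z) (at z)"
  shows "local_rep c T W (\<lambda>z. G' z (1, 0)) (dt T f)"
  unfolding local_rep_def
proof (intro allI impI)
  fix s y assume *: "(s, y) \<in> W" "s \<in> time_interval T" "y \<in> chart_image c"
  have "((\<lambda>s. f s (chart_inv c y)) has_vector_derivative (G' (s, snd c (chart_inv c y)) (1, 0)))
      (at s within time_interval T)"
    using * chart_inv[OF c] by (intro local_rep_has_dt[OF c _ W _ _ rep G]) auto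
  from has_vector_derivative_imp_dt[where f=f, OF T *(2) this]
  show "G' (s, y) (1, 0) = dt T f s (chart_inv c y)"
    using * chart_inv[OF c] by simp
qed

lemma C_family_local_rep:
  assumes c: "is_chart X c" "c \<in> A" "p \<in> fst c" and f: "C_family r A T f" "enat k \<le> r"
    and t: "t \<in> time_interval T"
  obtains W G where "open W" "(t, snd c p) \<in> W" "Ck_open k W G" "local_rep c T W G f"
proof -
  let ?S = "time_interval T \<times> chart_image c"
  have "C_on r ?S (\<lambda>(t, x). f t (chart_inv c x))" using f c by (simp add: C_family_def)
  moreover have "(t, snd c p) \<in> ?S" using t chart_inv(1)[OF c(1,3)] by simp
  ultimately obtain W G where "open W" "(t, snd c p) \<in> W" "\<forall>k. enat k \<le> r \<longrightarrow> Ck_open k W G"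
    "\<forall>y\<in>W \<inter> ?S. G y = (case y of (t, x) \<Rightarrow> f t (chart_inv c x))"
    unfolding C_on_def by blast
  then show ?thesis using f(2) by (intro that[of W G]) (auto simp: local_rep_def)
qed

lemma C1_family_has_pd:
  assumes c: "is_chart X c" "c \<in> A" "p \<in> fst c" and f: "C_family r A T f" "1 \<le> r"
    and t: "t \<in> time_interval T"
  shows "has_pd c i (f t) (pd c i (f t) p) p"
proof -
  obtain W G where W: "open W" "(t, snd c p) \<in> W" and G: "Ck_open 1 W G" and rep: "local_rep c T W G f"
    using C_family_local_rep[OF c f(1) _ t, of 1] f(2) by (metis one_enat_def)
  have "(G has_derivative frechet_derivative G (at (t, snd c p))) (at (t, snd c p))"
    using G W by (auto simp: frechet_derivative_works)
  from local_rep_has_pd[OF c(1,3) W t rep this] show ?thesis by (rule has_pd_pd)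
qed

text \<open>All second derivatives of \<open>f\<close> are values of the second derivative of one
  \<open>C^2\<close> extension \<open>G\<close> in the directions \<open>(1, 0)\<close> and
  \<open>(0, axis i 1)\<close>; its symmetry lets time and coordinate derivatives commute.\<close>

lemma C2_family_derivatives:
  fixes f :: "real \<Rightarrow> 'a \<Rightarrow> real^'m::finite"
  assumes c: "is_chart X c" "c \<in> A" "p \<in> fst c" and f: "C_family r A T f" "2 \<le> r"
    and T: "0 < T" and t: "t \<in> time_interval T"
  shows "((\<lambda>s. f s p) has_vector_derivative dt T f t p) (at t within time_interval T)"
    and "((\<lambda>s. dt T f s p) has_vector_derivative dt T (dt T f) t p) (at t within time_interval T)"
    and "((\<lambda>s. pd c i (f s) p) has_vector_derivative pd c i (dt T f t) p) (at t within time_interval T)"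
    and "has_pd c i (dt T f t) (pd c i (dt T f t) p) p"
    and "has_pd c i (pd c j (f t)) (pd c i (pd c j (f t)) p) p"
    and "pd c i (pd c j (f t)) p = pd c j (pd c i (f t)) p"
proof -
  obtain W G where W: "open W" "(t, snd c p) \<in> W" and G: "Ck_open 2 W G" and rep: "local_rep c T W G f"
    using C_family_local_rep[OF c f(1) _ t, of 2] f(2) by (metis numeral_eq_enat)
  define D where "D z = frechet_derivative G (at z)" for z
  define D2 where "D2 v z = frechet_derivative (\<lambda>z. D z v) (at z)" for v z
  have D: "(G has_derivative D z) (at z)" if "z \<in> W" for z
    using G that by (simp add: D_def numeral_2_eq_2 frechet_derivative_works)
  have D2: "((\<lambda>z. D z v) has_derivative D2 v z) (at z)" if "z \<in> W" for z v
    using G that by (simp add: D_def D2_def numeral_2_eq_2 del: split_paired_All flip: frechet_derivative_works)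
  have cont: "continuous_on W (\<lambda>z. D2 v z w)" for v w
    using G by (simp add: D_def D2_def numeral_2_eq_2 del: split_paired_All)
  have sym: "D2 v z w = D2 w z v" if "z \<in> W" for v w z
    by (rule mixed_directional_derivatives_eq[OF W(1) that D D2 D2 cont cont])
  let ?z = "(t, snd c p)"
  note rep_pd = local_rep_pd[OF c(1) W(1) rep D] and rep_dt = local_rep_dt[OF c(1) T W(1) rep D]
  have pd_pd: "has_pd c i (pd c j (f t)) (D2 (0, axis j 1) ?z (0, axis i 1)) p" for i j
    by (rule local_rep_has_pd[OF c(1,3) W t rep_pd D2[OF W(2)]])
  have pd_dt: "has_pd c i (dt T f t) (D2 (1, 0) ?z (0, axis i 1)) p"
    by (rule local_rep_has_pd[OF c(1,3) W t rep_dt D2[OF W(2)]])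
  show "((\<lambda>s. f s p) has_vector_derivative dt T f t p) (at t within time_interval T)"
    using local_rep_has_dt[OF c(1,3) W t rep D[OF W(2)]] has_vector_derivative_imp_dt[OF T t] by metis
  show "((\<lambda>s. dt T f s p) has_vector_derivative dt T (dt T f) t p) (at t within time_interval T)"
    using local_rep_has_dt[OF c(1,3) W t rep_dt D2[OF W(2)]] has_vector_derivative_imp_dt[OF T t, of "dt T f"]
    by metis
  show "((\<lambda>s. pd c i (f s) p) has_vector_derivative pd c i (dt T f t) p) (at t within time_interval T)"
    using local_rep_has_dt[OF c(1,3) W t rep_pd[of i] D2[OF W(2)]] sym[OF W(2)]
    by (simp add: has_pd_imp_pd[OF pd_dt])
  show "has_pd c i (dt T f t) (pd c i (dt T f t) p) p" by (rule has_pd_pd[OF pd_dt])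
  show "has_pd c i (pd c j (f t)) (pd c i (pd c j (f t)) p) p" by (rule has_pd_pd[OF pd_pd])
  show "pd c i (pd c j (f t)) p = pd c j (pd c i (f t)) p"
    by (simp add: has_pd_imp_pd[OF pd_pd] sym[OF W(2)])
qed

section \<open>Hypersurface geometry\<close>

lemma matrix_inv_right:
  fixes A :: "real^'n^'n"
  assumes "invertible A"
  shows "A ** matrix_inv A = mat 1"
  using someI_ex[OF assms[unfolded invertible_def]] by (simp add: matrix_inv_def)

text \<open>Linear algebra at a single point of a hypersurface: \<open>a i\<close> stands for the
  coordinate tangent vectors and \<open>B\<close> for the inverse metric.\<close>

locale hypersurface_frame =
  fixes a :: "'n::finite \<Rightarrow> real^'m::finite" and \<nu> :: "real^'m" and B :: "real^'n^'n"
  assumes codim: "CARD('m) = CARD('n) + 1"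
    and indep: "(\<Sum>i\<in>UNIV. x i *\<^sub>R a i) = 0 \<Longrightarrow> x = (\<lambda>_. 0)"
    and norm_normal: "norm \<nu> = 1"
    and normal: "\<nu> \<bullet> a i = 0"
    and B: "B = matrix_inv (\<chi> i j. a i \<bullet> a j)"
begin

lemma gram_inv: "(\<chi> i j. a i \<bullet> a j) ** B = mat 1"
  unfolding B by (intro matrix_inv_right gram_matrix_invertible indep)

lemma B_sym: "B $ i $ j = B $ j $ i"
proof -
  let ?g = "\<chi> i j. a i \<bullet> a j"
  have tr: "transpose ?g = ?g" by (simp add: transpose_def vec_eq_iff inner_commute)
  have "transpose B ** ?g = mat 1"
    using gram_inv by (metis matrix_transpose_mul tr transpose_mat)
  then have "transpose B = B"
    using gram_inv by (metis matrix_mul_assoc matrix_mul_lid matrix_mul_rid)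
  then show ?thesis by (metis transpose_def vec_lambda_beta)
qed

lemma gram_B_sum: "(\<Sum>k\<in>UNIV. (a i \<bullet> a k) * B $ k $ j) = (if i = j then 1 else 0)"
  using arg_cong[OF gram_inv, of "\<lambda>M. M $ i $ j"] by (simp add: matrix_matrix_mult_def mat_def)

text \<open>Subtracting the tangential projection, whose coefficients are the inner products with
  the index raised by \<open>B\<close>, leaves a vector orthogonal to the frame, and such a vector
  is a multiple of \<open>\<nu>\<close>.\<close>

lemma expansion:
  "w = (w \<bullet> \<nu>) *\<^sub>R \<nu> + (\<Sum>k\<in>UNIV. (\<Sum>l\<in>UNIV. B $ k $ l * (w \<bullet> a l)) *\<^sub>R a k)"
proof -
  let ?u = "w - (\<Sum>k\<in>UNIV. (\<Sum>l\<in>UNIV. B $ k $ l * (w \<bullet> a l)) *\<^sub>R a k)"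
  have "?u \<bullet> a i = 0" for i
  proof -
    have "(\<Sum>k\<in>UNIV. (\<Sum>l\<in>UNIV. B $ k $ l * (w \<bullet> a l)) *\<^sub>R a k) \<bullet> a i
      = (\<Sum>k\<in>UNIV. \<Sum>l\<in>UNIV. (a i \<bullet> a k) * B $ k $ l * (w \<bullet> a l))"
      by (simp add: inner_sum_left sum_distrib_right sum_distrib_left mult_ac inner_commute[of "a i"])
    also have "\<dots> = (\<Sum>l\<in>UNIV. (\<Sum>k\<in>UNIV. (a i \<bullet> a k) * B $ k $ l) * (w \<bullet> a l))"
      by (subst sum.swap) (simp add: sum_distrib_right)
    also have "\<dots> = w \<bullet> a i" by (simp add: gram_B_sum if_distrib[of "\<lambda>x. x * _"] cong: if_cong)
    finally show ?thesis by (simp add: inner_diff_left)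
  qed
  from orthogonal_to_hyperplane_frame[OF codim indep norm_normal normal this]
  have "?u = (?u \<bullet> \<nu>) *\<^sub>R \<nu>" by simp
  moreover have "?u \<bullet> \<nu> = w \<bullet> \<nu>"
    by (simp add: inner_diff_left inner_sum_left normal inner_commute[of "a _" \<nu>])
  ultimately show ?thesis by (simp add: algebra_simps)
qed

lemma inner_expansion:
  "w \<bullet> y = (w \<bullet> \<nu>) * (\<nu> \<bullet> y) + (\<Sum>k\<in>UNIV. (\<Sum>l\<in>UNIV. B $ k $ l * (w \<bullet> a l)) * (a k \<bullet> y))"
proof -
  have "w \<bullet> y = ((w \<bullet> \<nu>) *\<^sub>R \<nu> + (\<Sum>k\<in>UNIV. (\<Sum>l\<in>UNIV. B $ k $ l * (w \<bullet> a l)) *\<^sub>R a k)) \<bullet> y"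
    using expansion[of w] by simp
  then show ?thesis by (simp add: inner_add_left inner_sum_left)
qed

text \<open>With \<open>B\<close> symmetric only the symmetric part of \<open>X\<close> counts. This
  merges the two halves of the derivative of the metric and makes skew contractions vanish.\<close>

lemma B_contract_swap: "(\<Sum>i\<in>UNIV. \<Sum>j\<in>UNIV. B $ i $ j * X i j) = (\<Sum>i\<in>UNIV. \<Sum>j\<in>UNIV. B $ i $ j * X j i)"
  by (subst sum.swap) (simp add: B_sym)

end

text \<open>\<open>pd c i f p\<close> is the image of the \<open>i\<close>-th axis vector under the
  derivative of the immersion in the chart, so injectivity of that derivative gives linear
  independence.\<close>

lemma hypersurface_frameI:
  assumes "CARD('m::finite) = CARD('n::finite) + 1"
    and c: "is_chart X c" "c \<in> A" "p \<in> fst c"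
    and imm: "immersion A (f :: 'a \<Rightarrow> real^'m)"
    and \<nu>: "norm \<nu> = 1" "\<And>i::'n. \<nu> \<bullet> pd c i f p = 0"
  shows "hypersurface_frame (\<lambda>i. pd c i f p) \<nu> (inv_metric c f p)"
proof
  let ?D = "frechet_derivative (f \<circ> chart_inv c) (at (snd c p))"
  have D: "(f \<circ> chart_inv c) differentiable at (snd c p)" "inj ?D"
    using imm c chart_inv(1)[OF c(1,3)] by (auto simp: immersion_def)
  have lin: "linear ?D" using D(1) by (rule linear_frechet_derivative)
  have pd: "pd c i f p = ?D (axis i 1)" for i
  proof (rule has_pd_imp_pd)
    have "((\<lambda>s. snd c p + s *\<^sub>R axis i 1) has_derivative (\<lambda>s. s *\<^sub>R axis i 1)) (at (0::real))"
      by (auto intro!: derivative_eq_intros)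
    from has_derivative_compose[OF this, of "f \<circ> chart_inv c" ?D] D(1)
    show "has_pd c i f (?D (axis i 1)) p"
      by (simp add: has_pd_def has_vector_derivative_def frechet_derivative_works linear_cmul[OF lin])
  qed
  fix x :: "'n \<Rightarrow> real"
  assume "(\<Sum>i\<in>UNIV. x i *\<^sub>R pd c i f p) = 0"
  then have "?D (\<Sum>i\<in>UNIV. x i *\<^sub>R axis i 1) = ?D 0"
    by (simp add: pd linear_sum[OF lin] linear_cmul[OF lin] linear_0[OF lin])
  then have "(\<Sum>i\<in>UNIV. x i *\<^sub>R axis i 1) = (0 :: real^'n)" using D(2) by (simp add: inj_eq)
  then have "(\<Sum>i\<in>UNIV. x i *\<^sub>R axis i 1) $ k = (0 :: real^'n) $ k" for k by simp
  then show "x = (\<lambda>_. 0)"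
    by (auto simp: axis_def if_distrib[of "\<lambda>y. _ * y"] cong: if_cong)
qed (use assms in \<open>auto simp: inv_metric_def metric_def\<close>)

text \<open>The Gauss formula turns the divergence of the tangential part of an ambient vector field \<open>w\<close>
  along the hypersurface into ambient derivatives of \<open>w\<close> and the mean curvature.\<close>

lemma divergence_tangential:
  fixes f :: "'a \<Rightarrow> real^'m::finite" and c :: "('a, 'n::finite) chart"
  assumes c: "is_chart X c" "p \<in> fst c"
    and frame: "hypersurface_frame (\<lambda>i. pd c i f p) (\<nu> p) (inv_metric c f p)"
    and \<nu>: "\<And>q i. q \<in> fst c \<Longrightarrow> \<nu> q \<bullet> pd c i f q = 0" "\<And>i. has_pd c i \<nu> (pd c i \<nu> p) p"
    and f: "\<And>i j. has_pd c i (pd c j f) (pd c i (pd c j f) p) p"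
      "\<And>i j. pd c i (pd c j f) p = pd c j (pd c i f) p"
    and w: "\<And>i. has_pd c i w (w' i) p"
  shows "divergence c f (\<lambda>k q. w q \<bullet> pd c k f q) p =
    (\<Sum>i\<in>UNIV. \<Sum>j\<in>UNIV. inv_metric c f p $ i $ j * (w' i \<bullet> pd c j f p))
    + (w p \<bullet> \<nu> p) * mean_curvature c f \<nu> p"
proof -
  interpret hypersurface_frame "\<lambda>i. pd c i f p" "\<nu> p" "inv_metric c f p" by (rule frame)
  define F2 where "F2 i j = pd c i (pd c j f) p" for i j
  have F2_sym: "F2 i j = F2 j i" for i j using f(2) by (simp add: F2_def)
  have f': "has_pd c i (pd c j f) (F2 i j) p" for i j using f(1) by (simp add: F2_def)
  \<comment> \<open>Differentiating the orthogonality of \<open>\<nu>\<close> and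
    \<open>pd c i f\<close> in direction \<open>j\<close> moves the derivative from the normal to
    the tangent vector.\<close>
  have h: "second_ff c f \<nu> i j p = F2 i j \<bullet> \<nu> p" for i j
  proof -
    have "has_pd c j (\<lambda>q. \<nu> q \<bullet> pd c i f q) (\<nu> p \<bullet> F2 j i + pd c j \<nu> p \<bullet> pd c i f p) p"
      by (rule has_pd_inner[OF c \<nu>(2) f'])
    moreover have "has_pd c j (\<lambda>q. \<nu> q \<bullet> pd c i f q) 0 p"
      by (rule has_pd_const_on_chart[OF c \<nu>(1)])
    ultimately have "\<nu> p \<bullet> F2 j i + pd c j \<nu> p \<bullet> pd c i f p = 0"
      by (auto dest!: has_pd_imp_pd)
    then show ?thesis by (simp add: second_ff_def F2_sym[of j i] inner_commute)
  qed
  have metric: "pd c i (\<lambda>q. metric c f q $ j $ l) p = pd c j f p \<bullet> F2 i l + F2 i j \<bullet> pd c l f p" for i j l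
    by (rule has_pd_imp_pd) (simp add: metric_def has_pd_inner[OF c f' f'])
  \<comment> \<open>Each metric derivative has two terms; by symmetry of \<open>F2\<close> four of
    the six cancel and the other two agree. So the Christoffel symbols are the tangential
    coefficients of \<open>F2 i j\<close>.\<close>
  have chr: "christoffel c f k i j p = (\<Sum>l\<in>UNIV. inv_metric c f p $ k $ l * (F2 i j \<bullet> pd c l f p))" for i j k
  proof -
    have "pd c i (\<lambda>q. metric c f q $ j $ l) p + pd c j (\<lambda>q. metric c f q $ i $ l) p
          - pd c l (\<lambda>q. metric c f q $ i $ j) p = 2 * (F2 i j \<bullet> pd c l f p)" for l
      unfolding metric F2_sym[of j i] F2_sym[of l _] by (simp add: inner_commute)
    then show ?thesis by (simp add: christoffel_def sum_divide_distrib)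
  qed
  have "nabla c f (\<lambda>k q. w q \<bullet> pd c k f q) i j p
      = w' i \<bullet> pd c j f p + (w p \<bullet> \<nu> p) * second_ff c f \<nu> i j p" for i j
  proof -
    have "pd c i (\<lambda>q. w q \<bullet> pd c j f q) p = w p \<bullet> F2 i j + w' i \<bullet> pd c j f p"
      by (rule has_pd_imp_pd[OF has_pd_inner[OF c w f']])
    \<comment> \<open>The Gauss formula paired with \<open>w p\<close>: its tangential part is
      exactly the connection term subtracted in \<open>nabla\<close>.\<close>
    moreover have "F2 i j \<bullet> w p = (F2 i j \<bullet> \<nu> p) * (\<nu> p \<bullet> w p)
        + (\<Sum>k\<in>UNIV. christoffel c f k i j p * (pd c k f p \<bullet> w p))"
      using inner_expansion[of "F2 i j" "w p"] by (simp add: chr)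
    ultimately show ?thesis by (simp add: nabla_def h inner_commute)
  qed
  then show ?thesis
    by (simp add: divergence_def mean_curvature_def sum.distrib sum_distrib_left algebra_simps)
qed

text \<open>Both terms in the derivative of the metric contribute equally to its trace with the
  inverse metric, which cancels the one half from the square root. The coordinate vectors
  \<open>v\<close> are fixed in time.\<close>

lemma volume_form_has_derivative:
  fixes f :: "real \<Rightarrow> 'a \<Rightarrow> real^'m::finite" and c :: "('a, 'n::finite) chart"
  assumes frame: "hypersurface_frame (\<lambda>i. pd c i (f t) p) \<nu> (inv_metric c (f t) p)"
    and f: "\<And>i. ((\<lambda>s. pd c i (f s) p) has_vector_derivative f' i) (at t within S)"
  shows "((\<lambda>s. volume_form c (f s) p v) has_real_derivative
    (\<Sum>i\<in>UNIV. \<Sum>j\<in>UNIV. inv_metric c (f t) p $ i $ j * (f' i \<bullet> pd c j (f t) p))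
      * volume_form c (f t) p v) (at t within S)"
proof -
  interpret hypersurface_frame "\<lambda>i. pd c i (f t) p" \<nu> "inv_metric c (f t) p" by (rule frame)
  let ?B = "inv_metric c (f t) p"
  let ?g' = "\<lambda>i j. pd c i (f t) p \<bullet> f' j + f' i \<bullet> pd c j (f t) p"
  let ?\<tau> = "\<Sum>i\<in>UNIV. \<Sum>j\<in>UNIV. ?B $ i $ j * (f' i \<bullet> pd c j (f t) p)"
  have g: "((\<lambda>s. metric c (f s) p $ i $ j) has_real_derivative ?g' i j) (at t within S)" for i j
    using bounded_bilinear.has_vector_derivative[OF bounded_bilinear_inner f[of i] f[of j]]
    by (simp add: metric_def has_real_derivative_iff_has_vector_derivative)
  have "metric c (f t) p ** ?B = mat 1" using gram_inv by (simp add: metric_def)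
  from has_real_derivative_sqrt_det[OF g this]
  have "((\<lambda>s. sqrt (det (metric c (f s) p))) has_real_derivative
    sqrt (det (metric c (f t) p)) * (\<Sum>i\<in>UNIV. \<Sum>j\<in>UNIV. ?B $ i $ j * ?g' j i) / 2) (at t within S)" .
  moreover have "(\<Sum>i\<in>UNIV. \<Sum>j\<in>UNIV. ?B $ i $ j * ?g' j i) = 2 * ?\<tau>"
    using B_contract_swap[of "\<lambda>i j. f' i \<bullet> pd c j (f t) p"]
    by (simp add: distrib_left sum.distrib inner_commute)
  ultimately have "((\<lambda>s. sqrt (det (metric c (f s) p))) has_real_derivative
    sqrt (det (metric c (f t) p)) * ?\<tau>) (at t within S)" by simp
  from DERIV_cmult_right[OF this, of "det (\<chi> i. v i)"] show ?thesis
    by (simp add: volume_form_def mult_ac)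
qed

section \<open>Killing fields\<close>

lemma killing_field_derivative:
  assumes "killing_field Y"
  shows "(Y has_derivative frechet_derivative Y (at y)) (at y)"
    and "v \<bullet> frechet_derivative Y (at y) v = 0"
    and "frechet_derivative Y (at y) v \<bullet> w = - (frechet_derivative Y (at y) w \<bullet> v)"
proof -
  have Y: "C_on \<infinity> UNIV Y"
    and *: "frechet_derivative Y (at y) v \<bullet> w + v \<bullet> frechet_derivative Y (at y) w = 0" for v w y
    using assms by (auto simp: killing_field_def)
  \<comment> \<open>\<open>C_on\<close> supplies only a local map \<open>g\<close>;
    differentiability passes to \<open>Y\<close> because the two agree on the open set
    \<open>W\<close>.\<close>
  obtain W g where W: "open W" "y \<in> W" and g: "\<And>k. Ck_open k W g" "\<And>z. z \<in> W \<Longrightarrow> g z = Y z"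
    using Y unfolding C_on_def by simp metis
  have "(g has_derivative frechet_derivative g (at y)) (at y)"
    using g(1)[of 1] W by (simp flip: frechet_derivative_works)
  from has_derivative_transform_within_open[OF this W g(2)]
  show "(Y has_derivative frechet_derivative Y (at y)) (at y)"
    using differentiableI frechet_derivative_works by blast
  show "v \<bullet> frechet_derivative Y (at y) v = 0"
    using *[of y v v] by (simp add: inner_commute)
  show "frechet_derivative Y (at y) v \<bullet> w = - (frechet_derivative Y (at y) w \<bullet> v)"
    using *[of y v w] by (simp add: inner_commute)
qed

text \<open>The identity of n-forms is tested in each chart on arbitrary coordinate vectors
  \<open>v\<close> that do not depend on time. The derivative within the time interval is one-sided
  at 0, and \<open>2 \<le> r\<close> makes precise how smooth the solution has to be.\<close>

theorem proposition4p2: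
  fixes X :: "'a topology"
    and A :: "('a, 'n::finite) chart set"
    and T :: ereal
    and r :: enat
    and F \<nu> :: "real \<Rightarrow> 'a \<Rightarrow> real^'m::finite"
    and Y :: "real^'m \<Rightarrow> real^'m"
  assumes codim: "CARD('m) = CARD('n) + 1"
    and M: "oriented_smooth_manifold X A"
    and T: "0 < T"
    and r: "2 \<le> r"
    and F: "C_family r A T F"
    and imm: "\<And>t. t \<in> time_interval T \<Longrightarrow> immersion A (F t)"
    and \<nu>: "unit_normal_field A T F \<nu>"
    and flow: "HMCF A T F \<nu>"
    and Y: "killing_field Y"
  shows "\<forall>t\<in>time_interval T. \<forall>c\<in>A. \<forall>p\<in>fst c. \<forall>v :: 'n \<Rightarrow> real^'n.
    ((\<lambda>s. (dt T F s p \<bullet> Y (F s p)) * volume_form c (F s) p v)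
      has_real_derivative
        divergence c (F t)
          (\<lambda>k q. (real CARD('n) - energy CARD('n) T F t q) * (pd c k (F t) q \<bullet> Y (F t q))) p
        * volume_form c (F t) p v)
      (at t within time_interval T)"
proof (intro ballI allI)
  fix t c p and v :: "'n \<Rightarrow> real^'n"
  assume t: "t \<in> time_interval T" and cA: "c \<in> A" and p: "p \<in> fst c"
  have chart: "is_chart X c" using M cA by (simp add: oriented_smooth_manifold_def)
  note c = chart cA p
  note F2 = C2_family_derivatives[OF c F r T t]
  have \<nu>C: "C_family 1 A T \<nu>" using \<nu> by (simp add: unit_normal_field_def)
  have \<nu>_normal: "norm (\<nu> t q) = 1" "\<nu> t q \<bullet> pd c i (F t) q = 0" if "q \<in> fst c" for q i
    using \<nu> t cA that by (auto simp: unit_normal_field_def)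
  have frame: "hypersurface_frame (\<lambda>i. pd c i (F t) p) (\<nu> t p) (inv_metric c (F t) p)"
    by (rule hypersurface_frameI[OF codim c imm[OF t] \<nu>_normal[OF p]])
  interpret hypersurface_frame "\<lambda>i. pd c i (F t) p" "\<nu> t p" "inv_metric c (F t) p" by (rule frame)
  define B where "B = inv_metric c (F t) p"
  define a where "a i = pd c i (F t) p" for i
  define N where "N = \<nu> t p"
  define V where "V = dt T F t p"
  define V' where "V' i = pd c i (dt T F t) p" for i
  define y where "y = Y (F t p)"
  define D where "D = frechet_derivative Y (at (F t p))"
  define e where "e = energy CARD('n) T F t p"
  define H where "H = mean_curvature c (F t) (\<nu> t) p"
  define dS where "dS = divergence c (F t) (S_form c T F t) p"
  define \<sigma> where "\<sigma> = V \<bullet> N"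
  \<comment> \<open>\<open>up\<close> raises an index, \<open>de\<close> is the differential of the
    energy (confirmed in \<open>pd_e\<close>), and \<open>\<tau>\<close> is the relative growth rate
    of the volume form.\<close>
  define up where "up \<omega> k = (\<Sum>l\<in>UNIV. B $ k $ l * \<omega> l)" for \<omega> :: "'n \<Rightarrow> real" and k
  define S where "S i = V \<bullet> a i" for i
  define de where "de i = V \<bullet> V' i" for i
  define \<tau> where "\<tau> = (\<Sum>i\<in>UNIV. \<Sum>j\<in>UNIV. B $ i $ j * (V' i \<bullet> a j))"
  have D: "(Y has_derivative D) (at (F t p))" and D0: "\<And>v. v \<bullet> D v = 0"
    and D_skew: "\<And>v w. D v \<bullet> w = - (D w \<bullet> v)"
    unfolding D_def by (rule killing_field_derivative[OF Y])+
  have pd_F: "has_pd c i (F t) (a i) p" for i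
    unfolding a_def by (rule C1_family_has_pd[OF c F _ t]) (use r order.trans[of 1 2 r] in simp)
  have pd_\<nu>: "has_pd c i (\<nu> t) (pd c i (\<nu> t) p) p" for i
    by (rule C1_family_has_pd[OF c \<nu>C _ t]) simp
  have pd_V: "has_pd c i (dt T F t) (V' i) p" for i
    unfolding V'_def by (rule F2(4))
  have pd_e: "has_pd c i (energy CARD('n) T F t) (de i) p" for i
  proof -
    have "has_pd c i (\<lambda>q. dt T F t q \<bullet> dt T F t q) (2 * de i) p"
      using has_pd_inner[OF chart p pd_V[of i] pd_V[of i]] by (simp add: V_def de_def inner_commute)
    then have "has_pd c i (\<lambda>q. (dt T F t q \<bullet> dt T F t q + real CARD('n)) / 2) (2 * de i / 2) p"
      unfolding has_pd_def has_real_derivative_iff_has_vector_derivative[symmetric]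
      by (intro DERIV_cdivide) (auto intro!: derivative_eq_intros)
    then show ?thesis by (simp add: energy_def[abs_def] power2_norm_eq_inner)
  qed
  have div: "divergence c (F t) (\<lambda>k q. w q \<bullet> pd c k (F t) q) p =
      (\<Sum>i\<in>UNIV. \<Sum>j\<in>UNIV. B $ i $ j * (w' i \<bullet> a j)) + (w p \<bullet> N) * H"
    if "\<And>i. has_pd c i w (w' i) p" for w w'
    unfolding B_def a_def N_def H_def
    by (rule divergence_tangential[OF chart p frame _ pd_\<nu> F2(5,6) that]) (rule \<nu>_normal(2))
  \<comment> \<open>The velocity itself is the ambient field here, since \<open>S_form\<close>
    consists of its tangential components.\<close>
  have dS: "dS = \<tau> + \<sigma> * H"
    using div[OF pd_V]
    by (simp add: dS_def S_form_def[abs_def] \<tau>_def \<sigma>_def V_def)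
  have "S_norm_sq c T F t p = (\<Sum>k\<in>UNIV. up S k * S k)"
    by (simp add: S_norm_sq_def S_form_def up_def S_def B_def V_def a_def sum_distrib_left sum_distrib_right mult_ac)
  moreover have "V \<bullet> V = \<sigma> * \<sigma> + (\<Sum>k\<in>UNIV. up S k * S k)"
    using inner_expansion[of V V] by (simp add: up_def S_def \<sigma>_def a_def B_def N_def inner_commute)
  moreover have "V \<bullet> V = 2 * e - real CARD('n)"
    by (simp add: e_def energy_def V_def power2_norm_eq_inner field_simps)
  \<comment> \<open>The squared speed is known twice: from the definition of the energy, and from
    the splitting into normal and tangential parts. Comparing both gives the factor of the final
    formula.\<close>
  ultimately have norm_V: "e - S_norm_sq c T F t p - \<sigma> * \<sigma> = real CARD('n) - e" by simp
  have V_y: "V \<bullet> y = \<sigma> * (N \<bullet> y) + (\<Sum>k\<in>UNIV. up S k * (a k \<bullet> y))"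
    using inner_expansion[of V y] by (simp add: up_def S_def \<sigma>_def a_def B_def N_def)
  have "dt T (dt T F) t p = ((e - S_norm_sq c T F t p) * H - \<sigma> * dS) *\<^sub>R N
      + (\<Sum>k\<in>UNIV. ((\<sigma> * H - dS) * up S k - up de k) *\<^sub>R a k)"
    using flow t cA p
    by (simp add: HMCF_def Let_def e_def H_def \<sigma>_def sigma_def V_def N_def dS_def raise_index_def
        S_form_def[abs_def] up_def S_def B_def a_def has_pd_imp_pd[OF pd_e])
  then have "dt T (dt T F) t p \<bullet> y = ((e - S_norm_sq c T F t p) * H - \<sigma> * dS) * (N \<bullet> y)
      + (\<Sum>k\<in>UNIV. ((\<sigma> * H - dS) * up S k - up de k) * (a k \<bullet> y))"
    by (simp add: inner_add_left inner_sum_left)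
  also have "(\<Sum>k\<in>UNIV. ((\<sigma> * H - dS) * up S k - up de k) * (a k \<bullet> y))
      = (\<sigma> * H - dS) * (V \<bullet> y - \<sigma> * (N \<bullet> y)) - (\<Sum>k\<in>UNIV. up de k * (a k \<bullet> y))"
    unfolding V_y by (simp add: left_diff_distrib sum_subtractf sum_distrib_left mult.assoc)
  \<comment> \<open>Inserting \<open>dS\<close> turns \<open>\<sigma> * H - dS\<close> into
    \<open>- \<tau>\<close>; the products of \<open>\<sigma>\<close> and \<open>\<tau>\<close>
    cancel, and the remaining \<open>\<sigma> * \<sigma> * H\<close> completes the factor in
    \<open>norm_V\<close>.\<close>
  also have "((e - S_norm_sq c T F t p) * H - \<sigma> * dS) * (N \<bullet> y)
      + ((\<sigma> * H - dS) * (V \<bullet> y - \<sigma> * (N \<bullet> y)) - (\<Sum>k\<in>UNIV. up de k * (a k \<bullet> y)))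
     = (e - S_norm_sq c T F t p - \<sigma> * \<sigma>) * H * (N \<bullet> y) - \<tau> * (V \<bullet> y) - (\<Sum>k\<in>UNIV. up de k * (a k \<bullet> y))"
    unfolding dS by (simp add: algebra_simps)
  finally have acc: "dt T (dt T F) t p \<bullet> y + \<tau> * (V \<bullet> y)
      = (real CARD('n) - e) * H * (N \<bullet> y) - (\<Sum>k\<in>UNIV. up de k * (a k \<bullet> y))"
    unfolding norm_V by simp

  \<comment> \<open>The divergence on the right-hand side\<close>
  have rhs: "divergence c (F t)
      (\<lambda>k q. (real CARD('n) - energy CARD('n) T F t q) * (pd c k (F t) q \<bullet> Y (F t q))) p
    = (real CARD('n) - e) * H * (N \<bullet> y) - (\<Sum>k\<in>UNIV. up de k * (a k \<bullet> y))"
  proof -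
    \<comment> \<open>The 1-form in question is the tangential part of this ambient field, so
      \<open>div\<close> applies to it.\<close>
    let ?w = "\<lambda>q. (real CARD('n) - energy CARD('n) T F t q) *\<^sub>R Y (F t q)"
    have "has_pd c i (\<lambda>q. real CARD('n) - energy CARD('n) T F t q) (- de i) p" for i
      using pd_e[of i] unfolding has_pd_def
      by (auto intro!: derivative_eq_intros)
    from has_pd_scaleR[OF chart p this has_pd_compose[OF chart p pd_F D]]
    have w: "has_pd c i ?w ((real CARD('n) - e) *\<^sub>R D (a i) - de i *\<^sub>R y) p" for i
      by (simp add: e_def y_def)
    \<comment> \<open>By skewness of \<open>D\<close> and symmetry of \<open>B\<close> the
      contraction equals its own negative.\<close>
    have "(\<Sum>i\<in>UNIV. \<Sum>j\<in>UNIV. B $ i $ j * (D (a i) \<bullet> a j))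
        = - (\<Sum>i\<in>UNIV. \<Sum>j\<in>UNIV. B $ i $ j * (D (a j) \<bullet> a i))"
      by (subst D_skew) (simp add: sum_negf)
    moreover have "\<dots> = - (\<Sum>i\<in>UNIV. \<Sum>j\<in>UNIV. B $ i $ j * (D (a i) \<bullet> a j))"
      using B_contract_swap[of "\<lambda>i j. D (a i) \<bullet> a j"] by (simp add: B_def)
    ultimately have skew: "(\<Sum>i\<in>UNIV. \<Sum>j\<in>UNIV. B $ i $ j * (D (a i) \<bullet> a j)) = 0" by linarith
    have "(\<Sum>i\<in>UNIV. \<Sum>j\<in>UNIV. B $ i $ j * (((real CARD('n) - e) *\<^sub>R D (a i) - de i *\<^sub>R y) \<bullet> a j))
       = (real CARD('n) - e) * (\<Sum>i\<in>UNIV. \<Sum>j\<in>UNIV. B $ i $ j * (D (a i) \<bullet> a j))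
         - (\<Sum>i\<in>UNIV. \<Sum>j\<in>UNIV. B $ i $ j * (de i * (a j \<bullet> y)))"
      by (simp add: inner_diff_left right_diff_distrib sum_subtractf sum_distrib_left mult_ac
          inner_commute[of y])
    also have "(\<Sum>i\<in>UNIV. \<Sum>j\<in>UNIV. B $ i $ j * (de i * (a j \<bullet> y))) = (\<Sum>k\<in>UNIV. up de k * (a k \<bullet> y))"
      using B_contract_swap[of "\<lambda>i j. de i * (a j \<bullet> y)"]
      by (simp add: B_def up_def sum_distrib_right sum_distrib_left mult_ac)
    finally have "(\<Sum>i\<in>UNIV. \<Sum>j\<in>UNIV. B $ i $ j * (((real CARD('n) - e) *\<^sub>R D (a i) - de i *\<^sub>R y) \<bullet> a j))
        = - (\<Sum>k\<in>UNIV. up de k * (a k \<bullet> y))"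
      by (simp add: skew)
    moreover have "?w p \<bullet> N = (real CARD('n) - e) * (N \<bullet> y)"
      by (simp add: e_def y_def inner_commute)
    ultimately show ?thesis
      using div[OF w] by (simp add: mult_ac inner_commute[of "Y _"])
  qed

  \<comment> \<open>The time derivative of the density\<close>
  have "((\<lambda>s. Y (F s p)) has_vector_derivative D V) (at t within time_interval T)"
  proof -
    have "linear D" using D has_derivative_linear by blast
    then show ?thesis
      using has_derivative_compose[OF F2(1)[unfolded has_vector_derivative_def] D]
      by (simp add: has_vector_derivative_def linear_cmul V_def)
  qed
  \<comment> \<open>The product rule also produces \<open>V \<bullet> D V\<close>, which vanishes by
    \<open>D0\<close>.\<close>
  from bounded_bilinear.has_vector_derivative[OF bounded_bilinear_inner F2(2) this]
  have "((\<lambda>s. dt T F s p \<bullet> Y (F s p)) has_real_derivative dt T (dt T F) t p \<bullet> y) (at t within time_interval T)"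
    by (simp add: has_real_derivative_iff_has_vector_derivative D0 flip: V_def y_def)
  moreover have "((\<lambda>s. volume_form c (F s) p v) has_real_derivative \<tau> * volume_form c (F t) p v)
      (at t within time_interval T)"
    unfolding \<tau>_def B_def a_def V'_def by (rule volume_form_has_derivative[OF frame F2(3)])
  ultimately have "((\<lambda>s. (dt T F s p \<bullet> Y (F s p)) * volume_form c (F s) p v) has_real_derivative
      dt T (dt T F) t p \<bullet> y * volume_form c (F t) p v + \<tau> * volume_form c (F t) p v * (V \<bullet> y))
      (at t within time_interval T)"
    using DERIV_mult by (fastforce simp: V_def y_def)
  also have "dt T (dt T F) t p \<bullet> y * volume_form c (F t) p v + \<tau> * volume_form c (F t) p v * (V \<bullet> y)
      = (dt T (dt T F) t p \<bullet> y + \<tau> * (V \<bullet> y)) * volume_form c (F t) p v"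
    by (simp add: algebra_simps)
  finally show "((\<lambda>s. (dt T F s p \<bullet> Y (F s p)) * volume_form c (F s) p v)
      has_real_derivative
        divergence c (F t)
          (\<lambda>k q. (real CARD('n) - energy CARD('n) T F t q) * (pd c k (F t) q \<bullet> Y (F t q))) p
        * volume_form c (F t) p v)
      (at t within time_interval T)"
    unfolding acc rhs .
qed

end
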